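(* Let $x\in(0,1)$ be irrational and $y\in[0,1]$ (with the one-sided point convention). Then $$\Omega(x,y)=\sigma_{slow}(x,y)\bigl(\Omega(\hat T_{slow}(x,y))\bigr).$$ Moreover, for every $k\ge0$, the left endpoint and the right endpoint of $I_{slow}(k)$ are $-\|\rho_{slow,0,k}\|x \bmod 1$ and $-\|\rho_{slow,1,k}\|x\bmod 1$, respectively, where $\|w\|$ is the length of the word $w$ (and $-0x$ is read as $0$ for a left endpoint and as $1$ for a right endpoint).
   Context: One-sided convention: for irrational $x$, each $y\in x\mathbb Z\bmod1$ has a left and a right version $y^-<y^+$; the circle is $[0^+,1^-]$; other points have one version. Intervals with such endpoints begin at the right version and end at the left version, so $[0,1-x]$ and $[1-x,1]$ are disjoint, and "$y\le1-x$", "$y\ge1-x$" mean membership in these intervals. Rotation $y\mapsto y+x$ mod 1 preserves versions. Let $T(x)=\frac1x-\lfloor\frac1x\rfloor$ and $$\hat T_{slow}(x,y)=\begin{cases}\left(T(1-x),\frac{y}{1-x}\right), & y\in[0,1-x]\text{ (red step)},\\ \left(T(x),\frac{1-y}{x}\right), & y\in[1-x,1]\text{ (green step)},\end{cases}$$ where $y\mapsto y/(1-x)$ preserves left/right versions and $y\mapsto(1-y)/x$ interchanges them. Symbolic coding: $\Omega(x,y)\in\{A,B\}^{\mathbb N}$ (indices $n\ge 0$), $\Omega(x,y)_n=A$ if $y+nx\bmod1\ge1-x$ and $\Omega(x,y)_n=B$ if $y+nx\bmod1\le1-x$. Substitutions (extended to infinite words): $\sigma_x(A)=AB^a$, $\sigma_x(B)=AB^{a-1}$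 with $a=\lfloor1/x\rfloor$; $\tau(A)=B$, $\tau(B)=A$. $\sigma_{slow}(x,y)=\sigma_x$ if $y\ge1-x$, and $\sigma_{slow}(x,y)=\tau\circ\sigma_{1-x}$ if $y\le1-x$. $\sigma_{slow}(x,y,0)=\mathrm{id}$ and $\sigma_{slow}(x,y,k+1)=\sigma_{slow}(x,y,k)\circ\sigma_{slow}(\hat T_{slow}^k(x,y))$. Intervals: $I_{slow}(0)=[0,1]$; given $I_{slow}(k)$, let $n$ be the least positive integer such that $-nx\bmod1$ lies in the interior of $I_{slow}(k)$; this point splits $I_{slow}(k)$ into two intervals and $I_{slow}(k+1)$ is the one containing $y$. Orientation: $\epsilon_0=1$, and $\epsilon_{k+1}=-\epsilon_k$ if the step of $\hat T_{slow}$ at $\hat T_{slow}^k(x,y)$ is green, $\epsilon_{k+1}=\epsilon_k$ if it is red. Words: $\rho_{slow,0,0}=\rho_{slow,1,0}=$ the empty word and, with $\cdot$ denoting concatenation, according to the step at $\hat T_{slow}^k(x,y)$: $\epsilon_k=1$, red: $\rho_{slow,0,k+1}=\rho_{slow,0,k}$, $\rho_{slow,1,k+1}=\sigma_{slow}(x,y,k)(B)\cdot\rho_{slow,1,k}$; $\epsilon_k=1$, green: $\rho_{slow,0,k+1}=\sigma_{slow}(x,y,k)(A)\cdot\rho_{slow,0,k}$, $\rho_{slow,1,k+1}=\rho_{slow,1,k}$; $\epsilon_k=-1$, red: $\rho_{slow,0,k+1}=\sigma_{slow}(x,y,k)(B)\cdot\rho_{slow,0,k}$, $\rho_{slow,1,k+1}=\rho_{slow,1,k}$;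 $\epsilon_k=-1$, green: $\rho_{slow,0,k+1}=\rho_{slow,0,k}$, $\rho_{slow,1,k+1}=\sigma_{slow}(x,y,k)(A)\cdot\rho_{slow,1,k}$. *)

theory Defs
  imports Complex_Main "HOL-Library.Stream"
begin

text \<open>
  A point consists of a real representative in the closed unit interval and a version.
  \<open>SingleV\<close> marks the points outside the orbit of 0, which have only one version.
\<close>

datatype version = LeftV | SingleV | RightV

type_synonym point = "real \<times> version"

fun swap_version :: "version \<Rightarrow> version" where
  "swap_version LeftV = RightV"
| "swap_version SingleV = SingleV"
| "swap_version RightV = LeftV"

definition two_sided :: "real \<Rightarrow> real \<Rightarrow> bool" where
  "two_sided x y \<longleftrightarrow> (\<exists>m n :: int. y = of_int m * x + of_int n)"

text \<open>The left version of the point 0 of the circle is represented by the real number 1.\<close>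

definition circle :: "real \<Rightarrow> point set" where
  "circle x = {(y, v). 0 \<le> y \<and> y \<le> 1 \<and>
     (if two_sided x y then (v = LeftV \<and> y \<noteq> 0) \<or> (v = RightV \<and> y \<noteq> 1) else v = SingleV)}"

fun version_rank :: "version \<Rightarrow> int" where
  "version_rank LeftV = - 1"
| "version_rank SingleV = 0"
| "version_rank RightV = 1"

definition point_le :: "point \<Rightarrow> point \<Rightarrow> bool" where
  "point_le p q \<longleftrightarrow>
     fst p < fst q \<or> (fst p = fst q \<and> version_rank (snd p) \<le> version_rank (snd q))"

definition ival :: "real \<Rightarrow> real \<Rightarrow> real \<Rightarrow> point set" where
  "ival x l r = {p \<in> circle x. point_le (l, RightV) p \<and> point_le p (r, LeftV)}"

text \<open>Left versions are reduced modulo 1 into (0,1], all other points into [0,1).\<close>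

definition translate :: "real \<Rightarrow> point \<Rightarrow> point" where
  "translate t = (\<lambda>(y, v). (if v = LeftV \<and> frac (y + t) = 0 then 1 else frac (y + t), v))"

definition gauss_map :: "real \<Rightarrow> real" where
  "gauss_map x = 1 / x - of_int \<lfloor>1 / x\<rfloor>"

definition red :: "real \<times> point \<Rightarrow> bool" where
  "red = (\<lambda>(x, p). p \<in> ival x 0 (1 - x))"

definition green :: "real \<times> point \<Rightarrow> bool" where
  "green = (\<lambda>(x, p). p \<in> ival x (1 - x) 1)"

definition T_slow :: "real \<times> point \<Rightarrow> real \<times> point" where
  "T_slow = (\<lambda>(x, (y, v)).
     if red (x, (y, v)) then (gauss_map (1 - x), (y / (1 - x), v))
     else (gauss_map x, ((1 - y) / x, swap_version v)))"

text \<open>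
  The definitions by cases (here and below) test only one of two complementary conditions.
\<close>

lemma ival_split:
  assumes "l < c" "c < r" "two_sided x c"
  shows "ival x l r = ival x l c \<union> ival x c r" "ival x l c \<inter> ival x c r = {}"
proof -
  have "(p \<in> ival x l r \<longleftrightarrow> p \<in> ival x l c \<or> p \<in> ival x c r)
      \<and> \<not> (p \<in> ival x l c \<and> p \<in> ival x c r)" for p
  proof -
    obtain y v where p: "p = (y, v)" by (cases p)
    have "v \<noteq> SingleV" if "y = c" "p \<in> circle x"
      using that assms(3) by (auto simp: circle_def p)
    with assms(1,2) show ?thesis
      by (cases v; cases "y < c"; cases "y = c") (auto simp: ival_def point_le_def p)
  qed
  then show "ival x l r = ival x l c \<union> ival x c r" "ival x l c \<inter> ival x c r = {}"
    by blast+
qed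

lemma two_sided_orbit: "two_sided x (frac (of_int m * x))"
  unfolding two_sided_def frac_def
  by (rule exI[of _ m], rule exI[of _ "- \<lfloor>of_int m * x\<rfloor>"]) simp

lemma circle_eq_ival: "ival x 0 1 = circle x"
proof -
  have "two_sided x 0"
    unfolding two_sided_def by (rule exI[of _ 0], rule exI[of _ 0]) simp
  moreover have "two_sided x 1"
    unfolding two_sided_def by (rule exI[of _ 0], rule exI[of _ 1]) simp
  ultimately have "point_le (0, RightV) (y, v) \<and> point_le (y, v) (1, LeftV)"
    if "(y, v) \<in> circle x" for y v
    using that by (cases "y = 0"; cases "y = 1"; cases v)
      (auto simp: circle_def point_le_def split: if_splits)
  then show ?thesis by (auto simp: ival_def)
qed

lemma green_iff_not_red:
  assumes "0 < x" "x < 1" "p \<in> circle x"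
  shows "green (x, p) \<longleftrightarrow> \<not> red (x, p)"
proof -
  have "two_sided x (1 - x)"
    unfolding two_sided_def by (rule exI[of _ "-1"], rule exI[of _ 1]) simp
  with ival_split[of 0 "1 - x" 1 x] assms show ?thesis
    by (auto simp: circle_eq_ival green_def red_def)
qed

datatype letter = A | B

definition Omega :: "real \<times> point \<Rightarrow> letter stream" where
  "Omega = (\<lambda>(x, p).
     smap (\<lambda>n. if green (x, translate (of_nat n * x) p) then A else B) nats)"

type_synonym subst = "letter \<Rightarrow> letter list"

definition subst_word :: "subst \<Rightarrow> letter list \<Rightarrow> letter list" where
  "subst_word s w = concat (map s w)"

definition subst_inf :: "subst \<Rightarrow> letter stream \<Rightarrow> letter stream" where
  "subst_inf s w = flat (smap s w)"

definition subst_id :: subst where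
  "subst_id c = [c]"

definition subst_comp :: "subst \<Rightarrow> subst \<Rightarrow> subst" where
  "subst_comp s t c = subst_word s (t c)"

fun sigma :: "real \<Rightarrow> subst" where
  "sigma x A = A # replicate (nat \<lfloor>1 / x\<rfloor>) B"
| "sigma x B = A # replicate (nat \<lfloor>1 / x\<rfloor> - 1) B"

fun tau :: subst where
  "tau A = [B]"
| "tau B = [A]"

definition sigma_slow :: "real \<times> point \<Rightarrow> subst" where
  "sigma_slow = (\<lambda>(x, p).
     if green (x, p) then sigma x else subst_comp tau (sigma (1 - x)))"

primrec sigma_slow_iter :: "real \<times> point \<Rightarrow> nat \<Rightarrow> subst" where
  "sigma_slow_iter q 0 = subst_id"
| "sigma_slow_iter q (Suc k) =
     subst_comp (sigma_slow_iter q k) (sigma_slow ((T_slow ^^ k) q))"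

text \<open>
  The interval is given by its endpoints \<open>(l, r)\<close> as real numbers; the corresponding set of
  points is \<open>ival x l r\<close>, from the right version of \<open>l\<close> to the left version of \<open>r\<close>.
\<close>

primrec I_slow :: "real \<times> point \<Rightarrow> nat \<Rightarrow> real \<times> real" where
  "I_slow q 0 = (0, 1)"
| "I_slow q (Suc k) =
     (let x = fst q; p = snd q; (l, r) = I_slow q k;
          n = (LEAST n::nat. 0 < n \<and> frac (- (of_nat n * x)) \<in> {l<..<r});
          c = frac (- (of_nat n * x))
      in if p \<in> ival x l c then (l, c) else (c, r))"

primrec orient :: "real \<times> point \<Rightarrow> nat \<Rightarrow> int" where
  "orient q 0 = 1"
| "orient q (Suc k) = (if green ((T_slow ^^ k) q) then - orient q k else orient q k)"

primrec rho_slow :: "real \<times> point \<Rightarrow> nat \<Rightarrow> letter list \<times> letter list" where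
  "rho_slow q 0 = ([], [])"
| "rho_slow q (Suc k) =
     (let (r0, r1) = rho_slow q k; s = sigma_slow_iter q k
      in if orient q k = 1
         then (if red ((T_slow ^^ k) q) then (r0, s B @ r1) else (s A @ r0, r1))
         else (if red ((T_slow ^^ k) q) then (s B @ r0, r1) else (r0, s A @ r1)))"

definition rho_slow0 :: "real \<times> point \<Rightarrow> nat \<Rightarrow> letter list" where
  "rho_slow0 q k = fst (rho_slow q k)"

definition rho_slow1 :: "real \<times> point \<Rightarrow> nat \<Rightarrow> letter list" where
  "rho_slow1 q k = snd (rho_slow q k)"

definition left_endpoint :: "real \<Rightarrow> nat \<Rightarrow> real" where
  "left_endpoint x n = (if n = 0 then 0 else frac (- (of_nat n * x)))"

definition right_endpoint :: "real \<Rightarrow> nat \<Rightarrow> real" where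
  "right_endpoint x n = (if n = 0 then 1 else frac (- (of_nat n * x)))"

end

theory Submission
  imports Defs
begin

text \<open>
  Both claims rest on inducing the rotation on one of the two intervals of the partition.

  For the first claim let \<open>y\<close> lie in the green interval \<open>[1 - x, 1]\<close>. Its orbit leaves with one
  letter \<open>A\<close>, passes through the red interval with \<open>a\<close> or \<open>a - 1\<close> letters \<open>B\<close>, where
  \<open>a = \<lfloor>1 / x\<rfloor>\<close>, and returns to the green interval. In the reversed and rescaled coordinate
  \<open>(1 - y) / x\<close> this first return is the rotation by the Gauss image of \<open>x\<close>, and there are \<open>a\<close>
  letters \<open>B\<close> exactly if the new coordinate is green (\<open>green_block\<close>). So the coding of \<open>y\<close> is the
  concatenation of the images of the letters in the coding of the new point. The red case is the
  green one seen in a mirror: \<open>y \<mapsto> 1 - y\<close> conjugates the rotation by \<open>x\<close> with that by \<open>1 - x\<close>,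
  exchanges the two intervals, and does not change the image under the slow map (\<open>T_slow_reflect\<close>,
  \<open>Omega_reflect\<close>).

  For the second claim, the same inducing is iterated inside the original circle. After \<open>k\<close> steps
  the current point of the slow orbit is the affine coordinate of \<open>p\<close> in a cell between two points
  \<open>s = - S x\<close> and \<open>e = - E x\<close>, where \<open>s\<close> has coordinate 0, \<open>e\<close> has coordinate 1, and \<open>s > e\<close> if the
  orientation is reversed. The rotation returns to the cell as the rotation by the current angle
  \<open>q\<close>, after \<open>a\<close> steps on its green part and after \<open>b\<close> steps on its red part; these return times
  are the lengths of the images of \<open>A\<close> and \<open>B\<close> under the composed substitution. The point \<open>c\<close> at
  coordinate \<open>1 - q\<close>, where the two parts meet, is carried to \<open>s\<close> in \<open>a\<close> steps from its green
  side and to \<open>e\<close> in \<open>b\<close> steps from its red side. Therefore \<open>c = - (S + a) x = - (E + b) x\<close>, and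
  \<open>c\<close> is the next splitting point (\<open>first_hit\<close>). A red step replaces \<open>e\<close> by \<open>c\<close> and adds \<open>b\<close> to
  \<open>E\<close>, while a green step makes \<open>e\<close> the new starting point and \<open>c\<close>, with index \<open>S + a\<close>, the new
  end. This is the recursion of the words \<open>\<rho>\<close>, whose lengths are \<open>S\<close> and \<open>E\<close> (\<open>slow_orbit_cell\<close>).
\<close>

section \<open>Reflection of the circle\<close>

definition reflect :: "point \<Rightarrow> point" where
  "reflect = (\<lambda>(y, v). (1 - y, swap_version v))"

lemma swap_version_swap_version [simp]: "swap_version (swap_version v) = v"
  by (cases v) auto

lemma version_rank_swap_version [simp]: "version_rank (swap_version v) = - version_rank v"
  by (cases v) auto

lemma reflect_reflect [simp]: "reflect (reflect p) = p"
  by (cases p) (simp add: reflect_def)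

lemma point_le_affine:
  assumes "0 < d"
  shows "point_le (t + d * u, V) (t + d * w, W) \<longleftrightarrow> point_le (u, V) (w, W)"
  using assms by (simp add: point_le_def)

lemma point_le_affine_rev:
  assumes "d < 0"
  shows "point_le (t + d * u, swap_version V) (t + d * w, swap_version W)
    \<longleftrightarrow> point_le (w, W) (u, V)"
  using assms by (auto simp: point_le_def)

lemma two_sided_reflect: "two_sided (1 - x) (1 - y) \<longleftrightarrow> two_sided x y"
proof -
  have "two_sided (1 - x) (1 - y)" if "two_sided x y" for x y
  proof -
    from that obtain m n :: int where "y = of_int m * x + of_int n"
      by (auto simp: two_sided_def)
    then have "1 - y = of_int m * (1 - x) + of_int (1 - n - m)"
      by (simp add: algebra_simps)
    then show ?thesis unfolding two_sided_def by blast
  qed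
  from this[of x y] this[of "1 - x" "1 - y"] show ?thesis by auto
qed

lemma reflect_in_circle:
  assumes "p \<in> circle x"
  shows "reflect p \<in> circle (1 - x)"
  using assms by (cases p; cases "snd p")
    (auto simp: circle_def reflect_def two_sided_reflect split: if_splits)

lemma green_reflect: "green (1 - x, reflect p) \<longleftrightarrow> red (x, p)"
proof -
  obtain y v where p: "p = (y, v)" by (cases p)
  have "reflect p \<in> circle (1 - x) \<longleftrightarrow> p \<in> circle x"
    using reflect_in_circle[of p x] reflect_in_circle[of "reflect p" "1 - x"] by auto
  then show ?thesis
    by (auto simp: green_def red_def ival_def point_le_def reflect_def p)
qed

lemma red_reflect: "red (1 - x, reflect p) \<longleftrightarrow> green (x, p)"
  using green_reflect[of "1 - x" "reflect p"] by simp

lemma T_slow_green: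
  assumes "0 < x" "x < 1" "green (x, (y, v))"
  shows "T_slow (x, (y, v)) = (gauss_map x, ((1 - y) / x, swap_version v))"
  using assms green_iff_not_red[of x "(y, v)"] by (auto simp: T_slow_def green_def ival_def)

text \<open>
  This reduces red steps to green ones: the mirror image of a red point is green for the angle
  \<open>1 - x\<close>, and the two branches of the slow map are exchanged by the reflection.
\<close>

lemma T_slow_reflect:
  assumes "0 < x" "x < 1" "p \<in> circle x"
  shows "T_slow (1 - x, reflect p) = T_slow (x, p)"
  using green_iff_not_red[OF assms] red_reflect[of x p]
  by (cases p) (auto simp: T_slow_def reflect_def)

section \<open>The slow map stays inside the space of one-sided points\<close>

lemma gauss_map_irrational:
  assumes "0 < x" "x < 1" "x \<notin> \<rat>"
  shows "0 < gauss_map x" "gauss_map x < 1" "gauss_map x \<notin> \<rat>"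
proof -
  show "gauss_map x < 1" unfolding gauss_map_def by linarith
  show "gauss_map x \<notin> \<rat>"
  proof
    assume "gauss_map x \<in> \<rat>"
    then have "gauss_map x + of_int \<lfloor>1 / x\<rfloor> \<in> \<rat>" by (intro Rats_add) auto
    then have "1 / x \<in> \<rat>" by (simp add: gauss_map_def)
    then have "inverse (1 / x) \<in> \<rat>" by (rule Rats_inverse)
    with assms(3) show False by simp
  qed
  moreover have "0 \<le> gauss_map x" unfolding gauss_map_def by linarith
  ultimately show "0 < gauss_map x" by (cases "gauss_map x = 0") auto
qed

lemma gauss_map_eq:
  assumes "0 < x" "x < 1" "a = nat \<lfloor>1 / x\<rfloor>"
  shows "1 = x * (gauss_map x + real a)" "1 \<le> a"
proof -
  have "1 \<le> \<lfloor>1 / x\<rfloor>" using assms by simp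
  then show "1 \<le> a" using assms(3) by linarith
  from \<open>1 \<le> \<lfloor>1 / x\<rfloor>\<close> have "real a = of_int \<lfloor>1 / x\<rfloor>" using assms(3) by linarith
  then show "1 = x * (gauss_map x + real a)" using assms(1) by (simp add: gauss_map_def)
qed

text \<open>
  The groups generated by \<open>x\<close> and 1 and by \<open>gauss_map x\<close> and 1 agree up to the factor \<open>x\<close>, because
  \<open>x * gauss_map x = 1 - a * x\<close> with an integer \<open>a\<close>. This is why versions survive a step of the
  slow map.
\<close>

lemma two_sided_gauss_map:
  assumes "0 < x" "x < 1"
  shows "two_sided (gauss_map x) ((1 - y) / x) \<longleftrightarrow> two_sided x y"
proof -
  define a where "a = nat \<lfloor>1 / x\<rfloor>"
  define q where "q = gauss_map x"
  have q: "x * q = 1 - real a * x"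
    using gauss_map_eq[OF assms a_def] by (simp add: q_def algebra_simps)
  show ?thesis unfolding q_def[symmetric]
  proof
    assume "two_sided q ((1 - y) / x)"
    then obtain m n :: int where "(1 - y) / x = of_int m * q + of_int n"
      by (auto simp: two_sided_def)
    then have "1 - y = x * (of_int m * q + of_int n)" using assms by (simp add: field_simps)
    also have "\<dots> = of_int m * (x * q) + of_int n * x" by (simp add: algebra_simps)
    finally have "y = of_int (m * int a - n) * x + of_int (1 - m)"
      unfolding q by (simp add: algebra_simps)
    then show "two_sided x y" unfolding two_sided_def by blast
  next
    assume "two_sided x y"
    then obtain m n :: int where y: "y = of_int m * x + of_int n"
      by (auto simp: two_sided_def)
    have "1 - y = (1 - of_int n) * 1 - of_int m * x" by (simp add: y)
    also have "\<dots> = (1 - of_int n) * (x * q + real a * x) - of_int m * x"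
      by (simp only: q) simp
    also have "\<dots> = x * (of_int (1 - n) * q + of_int ((1 - n) * int a - m))"
      by (simp add: algebra_simps)
    finally have "(1 - y) / x = of_int (1 - n) * q + of_int ((1 - n) * int a - m)"
      using assms by (simp add: field_simps)
    then show "two_sided q ((1 - y) / x)" unfolding two_sided_def by blast
  qed
qed

lemma green_imp_le:
  assumes "green (x, (y, v))"
  shows "(y, v) \<in> circle x" "1 - x \<le> y" "y \<le> 1" "y = 1 - x \<Longrightarrow> v = RightV"
    "y = 1 \<Longrightarrow> v = LeftV"
  using assms by (cases v; auto simp: green_def ival_def point_le_def)+

lemma T_slow_green_in_circle:
  assumes "0 < x" "x < 1" "green (x, (y, v))"
  shows "((1 - y) / x, swap_version v) \<in> circle (gauss_map x)"
proof -
  note le = green_imp_le[OF assms(3)]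
  define u where "u = (1 - y) / x"
  have y: "y = 1 - x * u" using assms(1) by (simp add: u_def)
  have "x * u \<le> x * 1" using le(2) by (simp add: y)
  then have u: "0 \<le> u" "u \<le> 1" using assms(1) le(3) by (simp_all add: u_def)
  have "u = 0 \<Longrightarrow> v = LeftV" "u = 1 \<Longrightarrow> v = RightV"
    using le(4,5) by (simp_all add: y)
  moreover have "two_sided (gauss_map x) u \<longleftrightarrow> two_sided x y"
    unfolding u_def by (rule two_sided_gauss_map[OF assms(1,2)])
  ultimately have "(u, swap_version v) \<in> circle (gauss_map x)"
    using u le(1) by (cases v) (auto simp: circle_def split: if_splits)
  then show ?thesis by (simp add: u_def)
qed

section \<open>The coding and its blocks\<close>

lemma stream_eqI: "(\<And>n. s !! n = t !! n) \<Longrightarrow> s = t"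
  by (coinduction arbitrary: s t) (metis snth.simps)

text \<open>
  If \<open>f z\<close> is the coding of the state \<open>z\<close> and \<open>g z\<close> that of its renormalization, it suffices to
  peel off one block and one letter at a time. Nonempty blocks make the recursion productive, so
  an induction on the position compares the two streams.
\<close>

lemma eq_flat_smapI:
  assumes step: "\<And>z. z \<in> Q \<Longrightarrow>
      \<exists>z'\<in>Q. f z = s (shd (g z)) @- f z' \<and> stl (g z) = g z'"
    and nonempty: "\<And>c. s c \<noteq> []"
    and "z \<in> Q"
  shows "f z = flat (smap s (g z))"
proof (rule stream_eqI)
  fix n
  from \<open>z \<in> Q\<close> show "f z !! n = flat (smap s (g z)) !! n"
  proof (induction n arbitrary: z rule: less_induct)
    case (less n)
    from step[OF less.prems] obtain z' where z': "z' \<in> Q"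
      "f z = s (shd (g z)) @- f z'" "stl (g z) = g z'" by blast
    let ?w = "s (shd (g z))"
    have "flat (smap s (g z)) = ?w @- flat (smap s (g z'))"
      using nonempty z'(3) flat_unfold[of "smap s (g z)"] by simp
    moreover have "f z' !! (n - length ?w) = flat (smap s (g z')) !! (n - length ?w)"
      if "length ?w \<le> n"
    proof -
      have "0 < length ?w" using nonempty by simp
      with that show ?thesis by (intro less.IH z'(1)) linarith
    qed
    ultimately show ?case
      using z'(2) by (cases "n < length ?w") auto
  qed
qed

lemma Omega_snth: "Omega (x, p) !! n = (if green (x, translate (real n * x) p) then A else B)"
  by (simp add: Omega_def)

lemma translate_translate: "translate s (translate t p) = translate (t + s) p"
proof -
  obtain y v where p: "p = (y, v)" by (cases p)
  have "frac (frac u + s) = frac (u + s)" for u :: real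
  proof -
    have "frac u + s = u + s - of_int \<lfloor>u\<rfloor>" by (simp add: frac_def)
    then show ?thesis unfolding frac_def by (simp only: floor_diff_of_int)
  qed
  from this[of "y + t"] have *: "frac (frac (y + t) + s) = frac (y + (t + s))"
    by (simp add: add.assoc)
  have "frac (1 + s) = frac s" using frac_1_eq[of s] by (simp add: add.commute)
  with * show ?thesis
    by (cases "frac (y + t) = 0") (simp_all add: translate_def p del: frac_eq_0_iff)
qed

lemma circle_imp_le:
  assumes "(y, v) \<in> circle x"
  shows "0 \<le> y" "y \<le> 1" "y = 0 \<Longrightarrow> v = RightV" "y = 1 \<Longrightarrow> v = LeftV"
proof -
  have "(y, v) \<in> ival x 0 1" using assms by (simp add: circle_eq_ival)
  then show "0 \<le> y" "y \<le> 1" "y = 0 \<Longrightarrow> v = RightV" "y = 1 \<Longrightarrow> v = LeftV"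
    by (cases v; auto simp: ival_def point_le_def)+
qed

lemma translate_0:
  assumes "p \<in> circle x"
  shows "translate 0 p = p"
proof -
  obtain y v where p: "p = (y, v)" by (cases p)
  note le = circle_imp_le[OF assms[unfolded p]]
  show ?thesis
  proof (cases "y = 1")
    case True
    with le(4) show ?thesis by (simp add: translate_def p frac_def)
  next
    case False
    then have "frac y = y" using le by (simp add: frac_eq)
    with le False show ?thesis by (auto simp: translate_def p simp del: frac_eq_0_iff)
  qed
qed

lemma Omega_Cons:
  assumes "p \<in> circle x"
  shows "Omega (x, p) = (if green (x, p) then A else B) ## Omega (x, translate x p)"
proof (rule stream_eqI)
  fix n
  show "Omega (x, p) !! n
      = ((if green (x, p) then A else B) ## Omega (x, translate x p)) !! n"
  proof (cases n)
    case 0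
    then show ?thesis using Omega_snth[of x p 0] translate_0[OF assms] by simp
  next
    case (Suc m)
    then show ?thesis
      unfolding Suc snth_Stream Omega_snth translate_translate by (simp add: algebra_simps)
  qed
qed

lemma two_sided_add:
  "two_sided x (y + (of_int i * x + of_int j)) \<longleftrightarrow> two_sided x y"
proof -
  have "two_sided x (y + (of_int i * x + of_int j))" if "two_sided x y" for y i j
  proof -
    from that obtain m n :: int where "y = of_int m * x + of_int n"
      by (auto simp: two_sided_def)
    then have "y + (of_int i * x + of_int j) = of_int (m + i) * x + of_int (n + j)"
      by (simp add: algebra_simps)
    then show ?thesis unfolding two_sided_def by blast
  qed
  from this[of y i j] this[of "y + (of_int i * x + of_int j)" "- i" "- j"]
  show ?thesis by auto
qed

lemma translate_green:
  assumes "0 < x" "x < 1" "green (x, (y, v))"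
  shows "translate x (y, v) = (y + x - 1, v)" "(y + x - 1, v) \<in> circle x"
proof -
  note le = green_imp_le[OF assms(3)]
  have "frac (y + x) = y + x - 1"
    using le assms(1,2) by (subst frac_unique_iff) auto
  then show "translate x (y, v) = (y + x - 1, v)"
    using le by (auto simp: translate_def simp del: frac_eq_0_iff)
  have "two_sided x (y + x - 1) \<longleftrightarrow> two_sided x y"
    using two_sided_add[of x y 1 "-1"] by (simp add: diff_diff_eq add_diff_eq)
  then show "(y + x - 1, v) \<in> circle x"
    using le assms(1,2) by (cases v) (auto simp: circle_def split: if_splits)
qed

lemma translate_red:
  assumes "0 < x" "x < 1" "red (x, (y, v))"
  shows "translate x (y, v) = (y + x, v)" "(y + x, v) \<in> circle x"
proof -
  have c: "(y, v) \<in> circle x" and le: "0 \<le> y" "y \<le> 1 - x" "y = 1 - x \<Longrightarrow> v = LeftV"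
    using assms(3) by (cases v; auto simp: red_def ival_def point_le_def)+
  have "frac (y + x) = (if y = 1 - x then 0 else y + x)"
    using le assms(1,2) by (subst frac_unique_iff) auto
  then show "translate x (y, v) = (y + x, v)"
    using le assms(1) by (auto simp: translate_def simp del: frac_eq_0_iff)
  have "two_sided x (y + x) \<longleftrightarrow> two_sided x y"
    using two_sided_add[of x y 1 0] by simp
  then show "(y + x, v) \<in> circle x"
    using c le assms(1,2) by (cases v) (auto simp: circle_def split: if_splits)
qed

text \<open>
  Each of the first \<open>i\<close> points of the run can still be translated by \<open>x\<close> within the circle, so it lies
  in the red interval.
\<close>

lemma Omega_red_run:
  assumes "0 < x" "x < 1" "(y, v) \<in> circle x" "point_le (y + real i * x, v) (1, LeftV)"
  shows "(y + real i * x, v) \<in> circle x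
    \<and> Omega (x, (y, v)) = replicate i B @- Omega (x, (y + real i * x, v))"
  using assms(3,4)
proof (induction i arbitrary: y)
  case 0
  then show ?case by simp
next
  case (Suc i)
  have le: "point_le (y + x + real i * x, v) (1, LeftV)"
    using Suc.prems(2) by (simp add: algebra_simps)
  have "0 \<le> real i * x" using assms(1) by simp
  with le have "point_le (y, v) (1 - x, LeftV)"
    by (cases v) (auto simp: point_le_def)
  then have "red (x, (y, v))"
    using Suc.prems(1) circle_imp_le[OF Suc.prems(1)]
    by (auto simp: red_def ival_def point_le_def)
  note step = translate_red[OF assms(1,2) this]
  have "\<not> green (x, (y, v))"
    using \<open>red (x, (y, v))\<close> green_iff_not_red[OF assms(1,2) Suc.prems(1)] by simp
  then have "Omega (x, (y, v)) = B ## Omega (x, (y + x, v))"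
    using Omega_Cons[OF Suc.prems(1)] step(1) by simp
  with Suc.IH[OF step(2) le] show ?case by (simp add: algebra_simps)
qed

text \<open>
  The witness is the first return of \<open>p\<close> to the green interval, found by transporting the rotated
  renormalized point \<open>(z, w)\<close> back to \<open>1 - x * z\<close>. That \<open>(z, w)\<close> is again a point of the circle
  says at once that this is the return, including the correct versions at the endpoints.
\<close>

lemma green_block:
  assumes "0 < x" "x < 1" "x \<notin> \<rat>" "green (x, p)"
  shows "\<exists>p'. green (x, p')
    \<and> Omega (x, p) = sigma x (shd (Omega (T_slow (x, p)))) @- Omega (x, p')
    \<and> stl (Omega (T_slow (x, p))) = Omega (T_slow (x, p'))"
proof -
  obtain y v where p: "p = (y, v)" by (cases p)
  note green = assms(4)[unfolded p]
  define q where "q = gauss_map x"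
  define a where "a = nat \<lfloor>1 / x\<rfloor>"
  define u where "u = (1 - y) / x"
  define w where "w = swap_version v"
  \<comment> \<open>the number of letters \<open>B\<close> before the return\<close>
  define j where "j = (if green (q, (u, w)) then a else a - 1)"
  define z where "z = u + q + real a - 1 - real j"
  note q = gauss_map_irrational[OF assms(1-3), folded q_def]
  note a = gauss_map_eq[OF assms(1,2) a_def, folded q_def]
  have T: "T_slow (x, p) = (q, (u, w))"
    using T_slow_green[OF assms(1,2) green] by (simp add: p q_def u_def w_def)
  have uw: "(u, w) \<in> circle q"
    using T_slow_green_in_circle[OF assms(1,2) green] by (simp add: q_def u_def w_def)
  have z: "translate q (u, w) = (z, w)" "(z, w) \<in> circle q"
    using translate_green[OF q(1,2), of u w] translate_red[OF q(1,2), of u w]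
      green_iff_not_red[OF q(1,2) uw] a(2)
    by (auto simp: z_def j_def of_nat_diff add_diff_eq)
  have "y = 1 - x * u" using assms(1) by (simp add: u_def)
  then have y': "y + x - 1 + real j * x = 1 - x * z"
    using a(1) by (simp add: z_def algebra_simps)
  have bounds: "point_le (1 - x * z, v) (1, LeftV)" "point_le (1 - x, RightV) (1 - x * z, v)"
  proof -
    note le = circle_imp_le[OF z(2)]
    have "0 \<le> x * z" "x * z \<le> x" "x * z = 0 \<longleftrightarrow> z = 0" "x * z = x \<longleftrightarrow> z = 1"
      using le(1,2) assms(1) by simp_all
    moreover have "z = 0 \<Longrightarrow> v = LeftV" "z = 1 \<Longrightarrow> v = RightV"
      using le(3,4) by (cases v; simp add: w_def)+
    ultimately show "point_le (1 - x * z, v) (1, LeftV)" "point_le (1 - x, RightV) (1 - x * z, v)"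
      by (auto simp: point_le_def le_less)
  qed
  note step = translate_green[OF assms(1,2) green]
  note run = Omega_red_run[OF assms(1,2) step(2), of j, unfolded y', OF bounds(1)]
  have green': "green (x, (1 - x * z, v))"
    using run bounds by (auto simp: green_def ival_def)
  have "Omega (x, p) = A ## replicate j B @- Omega (x, (1 - x * z, v))"
    using Omega_Cons[of p x] green green_imp_le(1)[OF green] step(1) run by (simp add: p)
  moreover have "sigma x (shd (Omega (T_slow (x, p)))) = A # replicate j B"
    unfolding T Omega_Cons[OF uw] by (simp add: j_def a_def)
  moreover have "stl (Omega (T_slow (x, p))) = Omega (T_slow (x, (1 - x * z, v)))"
    unfolding T Omega_Cons[OF uw] T_slow_green[OF assms(1,2) green']
    using assms(1) z(1) by (simp add: q_def w_def)
  ultimately show ?thesis using green' by (intro exI[of _ "(1 - x * z, v)"]) simp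
qed

lemma sigma_nonempty: "sigma x c \<noteq> []"
  by (cases c) auto

section \<open>The coding of the mirror image\<close>

fun flip :: "letter \<Rightarrow> letter" where
  "flip A = B"
| "flip B = A"

lemma tau_sigma: "subst_comp tau s c = map flip (s c)"
proof -
  have "tau d = [flip d]" for d by (cases d) auto
  then have "concat (map tau w) = map flip w" for w by (induction w) auto
  then show ?thesis by (simp add: subst_comp_def subst_word_def)
qed

text \<open>
  The convention that left versions are reduced into \<open>(0, 1]\<close> and the others into \<open>[0, 1)\<close> is
  symmetric under reflection. At 0 and 1 the symmetry depends on every point there being a left or a
  right version, which the reflection interchanges.
\<close>

lemma translate_reflect:
  assumes "p \<in> circle x"
  shows "translate (real n * (1 - x)) (reflect p) = reflect (translate (real n * x) p)"
proof -
  obtain y v where p: "p = (y, v)" by (cases p)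
  define t where "t = y + real n * x"
  have frac_add_of_int: "frac (u + of_int m) = frac u" for u :: real and m
    unfolding frac_def floor_add_int[symmetric] by simp
  have "1 - y + real n * (1 - x) = - t + of_int (1 + int n)"
    by (simp add: t_def algebra_simps)
  then have f: "frac (1 - y + real n * (1 - x)) = frac (- t)"
    by (simp only: frac_add_of_int)
  show ?thesis
  proof (cases "t \<in> \<int>")
    case True
    then obtain m :: int where "t = of_int m" by (auto elim: Ints_cases)
    then have "y = of_int (- int n) * x + of_int m" by (simp add: t_def)
    then have "two_sided x y" unfolding two_sided_def by blast
    then have "v \<noteq> SingleV" using assms by (auto simp: p circle_def)
    moreover have "frac t = 0" "frac (- t) = 0" using True by auto
    ultimately show ?thesis
      using f unfolding p reflect_def translate_def prod.case t_def[symmetric]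
      by (cases v) (simp_all add: t_def[symmetric] del: frac_eq_0_iff)
  next
    case False
    then have "frac (- t) = 1 - frac t" "frac t \<noteq> 0" "frac t \<noteq> 1"
      using frac_lt_1[of t] by (simp_all add: frac_neg)
    then show ?thesis
      using f unfolding p reflect_def translate_def t_def[symmetric]
      by (simp add: t_def[symmetric] del: frac_eq_0_iff)
  qed
qed

lemma translate_in_circle:
  assumes "0 < x" "x < 1" "p \<in> circle x"
  shows "translate (real n * x) p \<in> circle x"
proof (induction n)
  case 0
  show ?case using assms(3) translate_0[OF assms(3)] by simp
next
  case (Suc n)
  obtain y v where z: "translate (real n * x) p = (y, v)" by fastforce
  have "translate (real (Suc n) * x) p = translate x (y, v)"
    by (simp add: translate_translate z[symmetric] algebra_simps)
  then show ?case
    using Suc z green_iff_not_red[OF assms(1,2), of "(y, v)"]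
      translate_green[OF assms(1,2), of y v] translate_red[OF assms(1,2), of y v]
    by auto
qed

lemma Omega_reflect:
  assumes "0 < x" "x < 1" "p \<in> circle x"
  shows "Omega (1 - x, reflect p) = smap flip (Omega (x, p))"
proof (rule stream_eqI)
  fix n
  show "Omega (1 - x, reflect p) !! n = smap flip (Omega (x, p)) !! n"
    using green_iff_not_red[OF assms(1,2) translate_in_circle[OF assms, of n]]
    by (simp add: Omega_snth translate_reflect[OF assms(3)] green_reflect)
qed

text \<open>
  In the red case \<open>tau\<close> undoes the exchange of the letters that the reflection causes.
\<close>

lemma Omega_desubstitute:
  assumes "0 < x" "x < 1" "x \<notin> \<rat>" "p \<in> circle x"
  shows "Omega (x, p) = subst_inf (sigma_slow (x, p)) (Omega (T_slow (x, p)))"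
proof (cases "green (x, p)")
  case True
  have "Omega (x, p) = flat (smap (sigma x) (Omega (T_slow (x, p))))"
  proof (rule eq_flat_smapI[where Q = "{p. green (x, p)}" and f = "\<lambda>p. Omega (x, p)"
        and g = "\<lambda>p. Omega (T_slow (x, p))"])
    fix z assume "z \<in> {p. green (x, p)}"
    with green_block[OF assms(1-3), of z] show "\<exists>z'\<in>{p. green (x, p)}. Omega (x, z)
        = sigma x (shd (Omega (T_slow (x, z)))) @- Omega (x, z')
      \<and> stl (Omega (T_slow (x, z))) = Omega (T_slow (x, z'))"
      by (simp only: Bex_def mem_Collect_eq simp_thms)
  qed (use True sigma_nonempty in simp_all)
  with True show ?thesis by (simp add: subst_inf_def sigma_slow_def)
next
  case False
  let ?x = "1 - x"
  have x: "0 < ?x" "?x < 1" using assms(1,2) by auto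
  have "?x \<notin> \<rat>" using assms(3) Rats_diff[of 1 "1 - x"] by auto
  note block = green_block[OF x this]
  have red: "green (?x, reflect p)"
    using False green_iff_not_red[OF assms(1,2,4)] by (simp add: green_reflect)
  have "smap flip (Omega (?x, reflect p))
      = flat (smap (subst_comp tau (sigma ?x)) (Omega (T_slow (?x, reflect p))))"
  proof (rule eq_flat_smapI[where Q = "{p. green (?x, p)}"
        and f = "\<lambda>p. smap flip (Omega (?x, p))" and g = "\<lambda>p. Omega (T_slow (?x, p))"])
    fix z assume "z \<in> {p. green (?x, p)}"
    with block[of z] obtain z' where "green (?x, z')"
      "Omega (?x, z) = sigma ?x (shd (Omega (T_slow (?x, z)))) @- Omega (?x, z')"
      "stl (Omega (T_slow (?x, z))) = Omega (T_slow (?x, z'))" by auto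
    then show "\<exists>z'\<in>{p. green (?x, p)}. smap flip (Omega (?x, z))
        = subst_comp tau (sigma ?x) (shd (Omega (T_slow (?x, z)))) @- smap flip (Omega (?x, z'))
      \<and> stl (Omega (T_slow (?x, z))) = Omega (T_slow (?x, z'))"
      by (intro bexI[of _ z']) (simp_all add: tau_sigma)
  qed (use red sigma_nonempty in \<open>simp_all add: tau_sigma\<close>)
  moreover have "smap flip (Omega (?x, reflect p)) = Omega (x, p)"
    using Omega_reflect[OF x reflect_in_circle[OF assms(4)]] by simp
  ultimately show ?thesis
    using False T_slow_reflect[OF assms(1,2,4)] by (simp add: subst_inf_def sigma_slow_def)
qed

section \<open>Cells of the induced rotation\<close>

text \<open>
  The cell with ends \<open>s\<close> and \<open>e\<close>, on which the rotation by \<open>x\<close> induces the rotation by \<open>q\<close> in the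
  affine coordinate that is 0 at \<open>s\<close> and 1 at \<open>e\<close>. The case \<open>s > e\<close> is the reversed orientation;
  working with the signed length \<open>e - s\<close> avoids a case distinction in almost every computation.

  The induced rotation moves the green part by \<open>- (1 - q)\<close> and the red part by \<open>q\<close>, and
  \<open>displacement\<close> says that \<open>a\<close> and \<open>b\<close> steps of the original rotation do this modulo 1. The
  determinant condition makes \<open>(a, i)\<close> and \<open>(b, j)\<close> a basis of the integer lattice, so that every
  displacement between orbit points is a combination of these two. The inequalities in \<open>times\<close>
  hold because the rotation carries \<open>s\<close> and \<open>e\<close> to 0, which is never inside a cell, in \<open>S\<close> and \<open>E\<close>
  steps and hence before their first return to the cell: \<open>s\<close> borders the red part, with return time \<open>b\<close>, and \<open>e\<close> the green part, with return time \<open>a\<close>.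
\<close>

locale return_cell =
  fixes x :: real and p :: point and q :: real and z :: point
    and s :: real and S :: nat and e :: real and E :: nat and a b :: nat
  assumes x: "0 < x" "x < 1" "x \<notin> \<rat>" and p: "p \<in> circle x"
    and q: "0 < q" "q < 1" "q \<notin> \<rat>" and z: "z \<in> circle q"
    and bounds: "0 \<le> s" "s \<le> 1" "0 \<le> e" "e \<le> 1" "s \<noteq> e"
    and coordinate: "fst p = s + (e - s) * fst z"
      "snd p = (if s < e then snd z else swap_version (snd z))"
    and ends: "s + real S * x \<in> \<int>" "e + real E * x \<in> \<int>"
    and displacement: "\<exists>i j :: int. real a * x - of_int i = - ((1 - q) * (e - s))
      \<and> real b * x - of_int j = q * (e - s) \<and> \<bar>int a * j - int b * i\<bar> = 1"
    and times: "S + a = E + b" "S < b" "E < a"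
begin

definition c :: real where
  "c = s + (e - s) * (1 - q)"

lemma c_between: "min s e < c" "c < max s e"
proof -
  have e: "c = e + (s - e) * q" by (simp add: c_def algebra_simps)
  have "(e - s) * (1 - q) > 0 \<longleftrightarrow> s < e" "(e - s) * (1 - q) < 0 \<longleftrightarrow> e < s"
    "(s - e) * q < 0 \<longleftrightarrow> s < e" "(s - e) * q > 0 \<longleftrightarrow> e < s"
    using q by (simp_all add: zero_less_mult_iff mult_less_0_iff)
  moreover have "s < e \<or> e < s" using bounds(5) by linarith
  ultimately show "min s e < c" "c < max s e"
    using e c_def by linarith+
qed

lemma c_bounds: "0 < c" "c < 1"
  using c_between bounds by linarith+

lemma c_hits: "c + real (S + a) * x \<in> \<int>"
proof -
  from displacement obtain i :: int where "real a * x - of_int i = - ((1 - q) * (e - s))"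
    by blast
  then have "c = s - real a * x + of_int i" by (simp add: c_def algebra_simps)
  then have "c + real (S + a) * x = (s + real S * x) + of_int i"
    by (simp add: algebra_simps)
  also have "\<dots> \<in> \<int>" by (intro Ints_add ends(1)) simp
  finally show ?thesis .
qed

lemma frac_eq_c: "frac (- (real (S + a) * x)) = c"
proof -
  have "- (c + real (S + a) * x) \<in> \<int>" by (rule Ints_minus) (rule c_hits)
  then show ?thesis
    using c_bounds by (subst frac_unique_iff) (simp add: algebra_simps)
qed

text \<open>
  Let \<open>- n x\<close> lie inside the cell with \<open>n < S + a\<close>. It is reached from the point \<open>c\<close> in
  \<open>N = S + a - n\<close> rotation steps, and this displacement is \<open>f\<close> times that of the green part plus
  \<open>g\<close> times that of the red part, with \<open>N = f a + g b\<close>. If \<open>f\<close> and \<open>g\<close> are both positive, then \<open>N \<ge> a + b > S + a\<close>; if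
  neither is, then \<open>N \<le> 0\<close>. If exactly one is positive, then no term cancels the push of the
  other, which alone moves \<open>c\<close> to an end of the cell or beyond.
\<close>

lemma first_hit: "(LEAST n. 0 < n \<and> frac (- (real n * x)) \<in> {min s e<..<max s e}) = S + a"
proof (rule Least_equality)
  show "0 < S + a \<and> frac (- (real (S + a) * x)) \<in> {min s e<..<max s e}"
    using times c_between frac_eq_c by simp
next
  fix n assume n: "0 < n \<and> frac (- (real n * x)) \<in> {min s e<..<max s e}"
  show "S + a \<le> n"
  proof (rule ccontr)
    assume "\<not> S + a \<le> n"
    define N where "N = int (S + a) - int n"
    have N: "0 < N" "N < int a + int b"
      using \<open>\<not> S + a \<le> n\<close> n times(2) by (simp_all add: N_def)
    define w where "w = frac (- (real n * x))"
    \<comment> \<open>the coordinate of \<open>w\<close> in the cell\<close>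
    define t where "t = (w - s) / (e - s)"
    have w: "w = s + (e - s) * t" using bounds(5) by (simp add: t_def)
    have t: "0 < t" "t < 1"
      using n bounds(5) unfolding w_def[symmetric]
      by (cases "s < e"; simp add: t_def zero_less_divide_iff divide_less_eq)+
    from c_hits obtain k :: int where "c + real (S + a) * x = of_int k"
      by (elim Ints_cases)
    moreover define l where "l = - \<lfloor>- (real n * x)\<rfloor>"
    then have "w + real n * x = of_int l" by (simp add: w_def frac_def)
    ultimately obtain m :: int where m: "w - c = of_int N * x + of_int m"
      by (intro that[of "l - k"]) (simp add: N_def algebra_simps)
    from displacement obtain i j :: int
      where i: "real a * x - of_int i = - ((1 - q) * (e - s))"
        and j: "real b * x - of_int j = q * (e - s)"
        and det: "\<bar>int a * j - int b * i\<bar> = 1" by blast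
    define D where "D = int a * j - int b * i"
    have DD: "D * D = 1" using det unfolding D_def[symmetric] by (cases "0 \<le> D") auto
    \<comment> \<open>Cramer's rule for the lattice basis of determinant \<open>D\<close>\<close>
    define f where "f = D * (N * j + m * int b)"
    define g where "g = - D * (N * i + m * int a)"
    have "f * int a + g * int b = D * D * N"
      by (simp add: f_def g_def D_def algebra_simps)
    then have fgN: "N = f * int a + g * int b" by (simp add: DD)
    have "f * i + g * j = - (D * D * m)"
      by (simp add: f_def g_def D_def algebra_simps)
    then have fgm: "m = - (f * i + g * j)" by (simp add: DD)
    have "w - c = of_int f * (real a * x - of_int i) + of_int g * (real b * x - of_int j)"
      unfolding m fgm fgN by (simp add: algebra_simps)
    also have "\<dots> = (e - s) * (of_int g * q - of_int f * (1 - q))"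
      unfolding i j by (simp add: algebra_simps)
    finally have "(e - s) * t = (e - s) * (of_int g * q + (1 - of_int f) * (1 - q))"
      by (simp add: w c_def algebra_simps)
    then have t_eq: "t = of_int g * q + (1 - of_int f) * (1 - q)"
      using bounds(5) by simp
    consider "1 \<le> f" "1 \<le> g" | "1 \<le> f" "g \<le> 0" | "f \<le> 0" "1 \<le> g" | "f \<le> 0" "g \<le> 0"
      by linarith
    then show False
    proof cases
      case 1
      then have "1 * int a \<le> f * int a" "1 * int b \<le> g * int b"
        by (intro mult_right_mono; simp)+
      with fgN N(2) show False by linarith
    next
      case 2
      then have "of_int g * q \<le> 0" "(1 - of_int f) * (1 - q) \<le> 0"
        using q by (auto intro!: mult_nonpos_nonneg)
      with t_eq t(1) show False by linarith
    next
      case 3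
      then have "1 * q \<le> of_int g * q" "1 * (1 - q) \<le> (1 - of_int f) * (1 - q)"
        using q by (intro mult_right_mono; simp)+
      then have "1 * q + 1 * (1 - q) \<le> t" unfolding t_eq by (rule add_mono)
      with t(2) show False by simp
    next
      case 4
      then have "f * int a \<le> 0" "g * int b \<le> 0"
        by (auto intro!: mult_nonpos_nonneg)
      with fgN N(1) show False by linarith
    qed
  qed
qed

text \<open>
  Running through the cell backwards exchanges its ends and its two parts, and the conditions on the
  cell are symmetric under this exchange.
\<close>

lemma mirror: "return_cell x p (1 - q) (reflect z) e E s S b a"
proof
  show "1 - q \<notin> \<rat>" using q(3) Rats_diff[of 1 "1 - q"] by auto
  show "reflect z \<in> circle (1 - q)" by (rule reflect_in_circle[OF z])
  from displacement obtain i j :: int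
    where "real a * x - of_int i = - ((1 - q) * (e - s))"
      "real b * x - of_int j = q * (e - s)" "\<bar>int a * j - int b * i\<bar> = 1" by blast
  then show "\<exists>i j :: int. real b * x - of_int i = - ((1 - (1 - q)) * (s - e))
      \<and> real a * x - of_int j = (1 - q) * (s - e) \<and> \<bar>int b * j - int a * i\<bar> = 1"
    by (intro exI[of _ j] exI[of _ i])
      (simp add: abs_minus_commute algebra_simps)
qed (use x p q bounds ends times coordinate in
    \<open>auto simp: reflect_def case_prod_unfold algebra_simps\<close>)

text \<open>
  The green part of the cell is the new cell, with reversed orientation because the slow map reverses
  the green interval. Its new green points make one green and \<open>m\<close> red returns to the old cell, its new
  red points one red return less.
\<close>

lemma green_step:
  assumes "green (q, z)"
  defines "m \<equiv> nat \<lfloor>1 / q\<rfloor>"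
  shows "return_cell x p (gauss_map q) (snd (T_slow (q, z))) e E c (S + a)
      (a + m * b) (a + (m - 1) * b)"
    and "(if p \<in> ival x (min s e) c then (min s e, c) else (c, max s e)) = (min e c, max e c)"
proof -
  obtain u w where uw: "z = (u, w)" by (cases z)
  obtain y v where yv: "p = (y, v)" by (cases p)
  note green = assms(1)[unfolded uw]
  have m: "1 = q * (gauss_map q + real m)" "1 \<le> m"
    using gauss_map_eq[OF q(1,2), of m] by (simp_all add: m_def)
  obtain m' where m': "m = Suc m'" using m(2) by (cases m) auto
  have T: "snd (T_slow (q, z)) = ((1 - u) / q, swap_version w)"
    using T_slow_green[OF q(1,2) green] by (simp add: uw)
  have y: "y = s + (e - s) * u" and v: "v = (if s < e then w else swap_version w)"
    using coordinate by (simp_all add: uw yv)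
  have ec: "c - e = - ((e - s) * q)" by (simp add: c_def algebra_simps)
  have side: "e < c \<longleftrightarrow> \<not> s < e"
    using c_between by (auto simp: min_def max_def split: if_splits)
  show "return_cell x p (gauss_map q) (snd (T_slow (q, z))) e E c (S + a)
      (a + m * b) (a + (m - 1) * b)"
  proof
    show "snd (T_slow (q, z)) \<in> circle (gauss_map q)"
      unfolding T by (rule T_slow_green_in_circle[OF q(1,2) green])
    show "fst p = e + (c - e) * fst (snd (T_slow (q, z)))"
    proof -
      have "(c - e) * ((1 - u) / q) = - ((e - s) * (1 - u))" unfolding ec using q(1) by simp
      then show ?thesis unfolding T by (simp add: yv y algebra_simps)
    qed
    show "snd p = (if e < c then snd (snd (T_slow (q, z)))
        else swap_version (snd (snd (T_slow (q, z)))))"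
      unfolding T by (simp add: yv v side)
    show "e \<noteq> c" using c_between by (auto simp: min_def max_def split: if_splits)
    from displacement obtain i j :: int
      where i: "real a * x - of_int i = - ((1 - q) * (e - s))"
        and j: "real b * x - of_int j = q * (e - s)"
        and det: "\<bar>int a * j - int b * i\<bar> = 1" by blast
    have qm: "real m * q = 1 - q * gauss_map q"
      using m(1) by (simp add: algebra_simps)
    have "real (a + m * b) * x - of_int (i + int m * j)
        = (real a * x - of_int i) + real m * (real b * x - of_int j)"
      by (simp add: algebra_simps)
    also have "\<dots> = (e - s) * (real m * q - (1 - q))"
      unfolding i j by (simp add: algebra_simps)
    also have "\<dots> = - ((1 - gauss_map q) * (c - e))"
      unfolding qm ec by (simp add: algebra_simps)
    finally have A: "real (a + m * b) * x - of_int (i + int m * j)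
        = - ((1 - gauss_map q) * (c - e))" .
    have "real (a + (m - 1) * b) * x - of_int (i + int (m - 1) * j)
        = (real (a + m * b) * x - of_int (i + int m * j)) - (real b * x - of_int j)"
      by (simp add: m' algebra_simps)
    also have "\<dots> = gauss_map q * (c - e)"
      unfolding A j ec by (simp add: algebra_simps)
    finally have B: "real (a + (m - 1) * b) * x - of_int (i + int (m - 1) * j)
        = gauss_map q * (c - e)" .
    have "int (a + m * b) * (i + int (m - 1) * j) - int (a + (m - 1) * b) * (i + int m * j)
        = - (int a * j - int b * i)"
      by (simp add: m' algebra_simps)
    with det have "\<bar>int (a + m * b) * (i + int (m - 1) * j)
        - int (a + (m - 1) * b) * (i + int m * j)\<bar> = 1"
      by simp
    with A B show "\<exists>i j :: int.
        real (a + m * b) * x - of_int i = - ((1 - gauss_map q) * (c - e))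
      \<and> real (a + (m - 1) * b) * x - of_int j = gauss_map q * (c - e)
      \<and> \<bar>int (a + m * b) * j - int (a + (m - 1) * b) * i\<bar> = 1"
      by blast
    have b: "b \<le> m * b" "m * b = (m - 1) * b + b"
      by (simp_all add: m')
    show "E + (a + m * b) = S + a + (a + (m - 1) * b)" using times(1) b(2) by simp
    show "E < a + (m - 1) * b" "S + a < a + m * b" using times b(1) by linarith+
  qed (use x p gauss_map_irrational[OF q] bounds ends c_bounds c_hits in auto)
  have le: "point_le (1 - q, RightV) (u, w)" "point_le (u, w) (1, LeftV)"
    using green by (simp_all add: green_def ival_def)
  show "(if p \<in> ival x (min s e) c then (min s e, c) else (c, max s e)) = (min e c, max e c)"
  proof (cases "s < e")
    case True
    then have "point_le (c, RightV) p"
      using point_le_affine[of "e - s" s "1 - q" RightV u w] le(1)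
      by (simp add: c_def yv y v)
    then have "p \<notin> ival x (min s e) c"
      by (cases v) (auto simp: yv ival_def point_le_def)
    then show ?thesis using True side by simp
  next
    case False
    then have "e - s < 0" using bounds(5) by simp
    from point_le_affine_rev[OF this, of s u w "1 - q" RightV]
      point_le_affine_rev[OF this, of s 1 LeftV u w] le False
    have "point_le p (c, LeftV)" "point_le (e, RightV) p"
      by (simp_all add: c_def yv y v)
    then have "p \<in> ival x (min s e) c" using p False by (simp add: ival_def min_def)
    then show ?thesis using False side by (simp add: min_def max_def)
  qed
qed

text \<open>
  The mirror image of a red point is green, so the previous lemma applies to the mirrored cell. The
  two reversals of orientation cancel.
\<close>

lemma red_step:
  assumes "red (q, z)"
  defines "m \<equiv> nat \<lfloor>1 / (1 - q)\<rfloor>"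
  shows "return_cell x p (gauss_map (1 - q)) (snd (T_slow (q, z))) s S c (S + a)
      (b + m * a) (b + (m - 1) * a)"
    and "(if p \<in> ival x (min s e) c then (min s e, c) else (c, max s e)) = (min s c, max s c)"
proof -
  interpret mirror: return_cell x p "1 - q" "reflect z" e E s S b a by (rule mirror)
  have "green (1 - q, reflect z)" using assms(1) by (simp add: green_reflect)
  note step = mirror.green_step[OF this]
  have c: "mirror.c = c" by (simp add: mirror.c_def c_def algebra_simps)
  show "return_cell x p (gauss_map (1 - q)) (snd (T_slow (q, z))) s S c (S + a)
      (b + m * a) (b + (m - 1) * a)"
    using step(1) times(1) T_slow_reflect[OF q(1,2) z] by (simp add: c m_def)
  show "(if p \<in> ival x (min s e) c then (min s e, c) else (c, max s e)) = (min s c, max s c)"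
    using step(2) unfolding c min.commute[of e s] max.commute[of e s] .
qed

end

section \<open>Following the cells along the slow orbit\<close>

lemma length_subst_word_replicate:
  "length (subst_word t (d # replicate m d')) = length (t d) + m * length (t d')"
  by (induction m) (simp_all add: subst_word_def)

lemma length_subst_comp_sigma_slow:
  assumes "0 < q" "q < 1" "z \<in> circle q"
  shows "green (q, z) \<Longrightarrow> length (subst_comp t (sigma_slow (q, z)) A)
      = length (t A) + nat \<lfloor>1 / q\<rfloor> * length (t B)"
    and "green (q, z) \<Longrightarrow> length (subst_comp t (sigma_slow (q, z)) B)
      = length (t A) + (nat \<lfloor>1 / q\<rfloor> - 1) * length (t B)"
    and "red (q, z) \<Longrightarrow> length (subst_comp t (sigma_slow (q, z)) A)
      = length (t B) + nat \<lfloor>1 / (1 - q)\<rfloor> * length (t A)"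
    and "red (q, z) \<Longrightarrow> length (subst_comp t (sigma_slow (q, z)) B)
      = length (t B) + (nat \<lfloor>1 / (1 - q)\<rfloor> - 1) * length (t A)"
  using green_iff_not_red[OF assms]
  by (simp_all add: subst_comp_def[of t] sigma_slow_def tau_sigma
      length_subst_word_replicate)

lemma return_cell_0:
  assumes "0 < x" "x < 1" "x \<notin> \<rat>" "p \<in> circle x"
  shows "return_cell x p x p 0 0 1 0 1 1"
proof
  show "\<exists>i j :: int. real 1 * x - of_int i = - ((1 - x) * (1 - 0))
      \<and> real 1 * x - of_int j = x * (1 - 0) \<and> \<bar>int 1 * j - int 1 * i\<bar> = 1"
    by (intro exI[of _ 1] exI[of _ 0]) simp
qed (use assms in auto)

text \<open>
  The word \<open>rho_slow0\<close> always belongs to the left end and \<open>rho_slow1\<close> to the right one, whereas \<open>s\<close> and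
  \<open>e\<close> are the starting and the final end in the orientation of the cell. A red step changes the word
  of the end \<open>e\<close> and a green step that of \<open>s\<close>, which is why the recursion depends on the
  orientation.
\<close>

lemma slow_orbit_cell:
  assumes "0 < x" "x < 1" "x \<notin> \<rat>" "p \<in> circle x"
  shows "\<exists>s S e E. return_cell x p (fst ((T_slow ^^ k) (x, p))) (snd ((T_slow ^^ k) (x, p)))
        s S e E (length (sigma_slow_iter (x, p) k A)) (length (sigma_slow_iter (x, p) k B))
      \<and> I_slow (x, p) k = (min s e, max s e)
      \<and> (if s < e
         then orient (x, p) k = 1
           \<and> length (rho_slow0 (x, p) k) = S \<and> length (rho_slow1 (x, p) k) = E
         else orient (x, p) k = - 1
           \<and> length (rho_slow0 (x, p) k) = E \<and> length (rho_slow1 (x, p) k) = S)"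
proof (induction k)
  case 0
  show ?case
    using return_cell_0[OF assms]
    by (intro exI[of _ "0::real"] exI[of _ "0::nat"] exI[of _ "1::real"])
      (simp add: subst_id_def rho_slow0_def rho_slow1_def)
next
  case (Suc k)
  define q where "q = fst ((T_slow ^^ k) (x, p))"
  define z where "z = snd ((T_slow ^^ k) (x, p))"
  define t where "t = sigma_slow_iter (x, p) k"
  have qz: "(T_slow ^^ k) (x, p) = (q, z)" by (simp add: q_def z_def)
  have qz': "(T_slow ^^ Suc k) (x, p) = T_slow (q, z)" by (simp add: qz)
  from Suc.IH obtain s S e E where cell: "return_cell x p q z s S e E (length (t A)) (length (t B))"
    and I: "I_slow (x, p) k = (min s e, max s e)"
    and or: "if s < e
       then orient (x, p) k = 1
         \<and> length (rho_slow0 (x, p) k) = S \<and> length (rho_slow1 (x, p) k) = E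
       else orient (x, p) k = - 1
         \<and> length (rho_slow0 (x, p) k) = E \<and> length (rho_slow1 (x, p) k) = S"
    unfolding q_def z_def t_def by blast
  interpret return_cell x p q z s S e E "length (t A)" "length (t B)" by (rule cell)
  have I': "I_slow (x, p) (Suc k)
      = (if p \<in> ival x (min s e) c then (min s e, c) else (c, max s e))"
    unfolding I_slow.simps Let_def I fst_conv snd_conv prod.case first_hit frac_eq_c ..
  note lengths = length_subst_comp_sigma_slow[OF q(1,2) z, of t]
  have t': "sigma_slow_iter (x, p) (Suc k) = subst_comp t (sigma_slow (q, z))"
    by (simp add: qz t_def)
  obtain r0 r1 where r: "rho_slow (x, p) k = (r0, r1)" by fastforce
  have side: "s < c \<longleftrightarrow> s < e" "e < c \<longleftrightarrow> \<not> s < e"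
    using c_between by (auto simp: min_def max_def split: if_splits)
  show ?case
  proof (cases "green (q, z)")
    case True
    then have not_red: "\<not> red (q, z)" using green_iff_not_red[OF q(1,2) z] by simp
    have fst: "fst (T_slow (q, z)) = gauss_map q"
      using True T_slow_green[OF q(1,2)] by (cases z) auto
    have "return_cell x p (fst (T_slow (q, z))) (snd (T_slow (q, z))) e E c (S + length (t A))
        (length (subst_comp t (sigma_slow (q, z)) A))
        (length (subst_comp t (sigma_slow (q, z)) B))"
      unfolding fst lengths(1,2)[OF True] by (rule green_step(1)[OF True])
    then show ?thesis
      unfolding qz' t' I' green_step(2)[OF True]
      using or True not_red
      by (intro exI[of _ e] exI[of _ E] exI[of _ c] exI[of _ "S + length (t A)"])
        (auto simp: side qz r rho_slow0_def rho_slow1_def t_def split: if_splits)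
  next
    case False
    then have red: "red (q, z)" using green_iff_not_red[OF q(1,2) z] by simp
    have fst: "fst (T_slow (q, z)) = gauss_map (1 - q)"
      using red by (cases z) (simp add: T_slow_def)
    have "return_cell x p (fst (T_slow (q, z))) (snd (T_slow (q, z))) s S c (S + length (t A))
        (length (subst_comp t (sigma_slow (q, z)) A))
        (length (subst_comp t (sigma_slow (q, z)) B))"
      unfolding fst lengths(3,4)[OF red] by (rule red_step(1)[OF red])
    then show ?thesis
      unfolding qz' t' I' red_step(2)[OF red]
      using or False red times(1)
      by (intro exI[of _ s] exI[of _ S] exI[of _ c] exI[of _ "S + length (t A)"])
        (auto simp: side qz r rho_slow0_def rho_slow1_def t_def split: if_splits)
  qed
qed

lemma left_endpoint_eq:
  assumes "0 \<le> l" "l < 1" "l + real n * x \<in> \<int>"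
  shows "l = left_endpoint x n"
proof -
  have "- (l + real n * x) \<in> \<int>" using assms(3) by (rule Ints_minus)
  also have "- (l + real n * x) = - (real n * x) - l" by simp
  finally have "frac (- (real n * x)) = l"
    using assms(1,2) by (subst frac_unique_iff) simp
  then show ?thesis by (auto simp: left_endpoint_def)
qed

text \<open>
  Since \<open>x\<close> is irrational, no positive multiple of it is an integer, so that the end 1 forces the
  index 0.
\<close>

lemma right_endpoint_eq:
  assumes "0 < r" "r \<le> 1" "r + real n * x \<in> \<int>" "x \<notin> \<rat>"
  shows "r = right_endpoint x n"
proof (cases "r = 1")
  case True
  have "n = 0"
  proof (rule ccontr)
    assume "n \<noteq> 0"
    have "real n * x \<in> \<int>" using Ints_diff[OF assms(3) Ints_1] True by simp
    then have "real n * x \<in> \<rat>" using Ints_subset_Rats by blast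
    then have "real n * x / real n \<in> \<rat>" by (intro Rats_divide) auto
    with \<open>n \<noteq> 0\<close> assms(4) show False by simp
  qed
  with True show ?thesis by (simp add: right_endpoint_def)
next
  case False
  then have r: "r = left_endpoint x n"
    using assms by (intro left_endpoint_eq) auto
  with assms(1) show ?thesis
    by (cases "n = 0") (simp_all add: right_endpoint_def left_endpoint_def)
qed

theorem lemma3p3:
  fixes x :: real and p :: point
  assumes "0 < x" and "x < 1" and "x \<notin> \<rat>" and "p \<in> circle x"
  shows "Omega (x, p) = subst_inf (sigma_slow (x, p)) (Omega (T_slow (x, p))) \<and>
    (\<forall>k. fst (I_slow (x, p) k) = left_endpoint x (length (rho_slow0 (x, p) k)) \<and>
         snd (I_slow (x, p) k) = right_endpoint x (length (rho_slow1 (x, p) k)))"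
proof (intro conjI allI)
  show "Omega (x, p) = subst_inf (sigma_slow (x, p)) (Omega (T_slow (x, p)))"
    by (rule Omega_desubstitute[OF assms])
next
  fix k
  from slow_orbit_cell[OF assms, of k] obtain s S e E q z a b
    where "return_cell x p q z s S e E a b"
      and I: "I_slow (x, p) k = (min s e, max s e)"
      and or: "if s < e
         then length (rho_slow0 (x, p) k) = S \<and> length (rho_slow1 (x, p) k) = E
         else length (rho_slow0 (x, p) k) = E \<and> length (rho_slow1 (x, p) k) = S"
    by metis
  then interpret return_cell x p q z s S e E a b by simp
  show "fst (I_slow (x, p) k) = left_endpoint x (length (rho_slow0 (x, p) k))"
    unfolding I using or bounds ends
    by (intro left_endpoint_eq) (auto split: if_splits)
  show "snd (I_slow (x, p) k) = right_endpoint x (length (rho_slow1 (x, p) k))"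
    unfolding I using or bounds ends
    by (intro right_endpoint_eq x(3)) (auto split: if_splits)
qed

end
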